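(* Consider the problem $\min\{f(x): x\in X,\ g(x)\le 0\}$ with a solution $x_*$, and assume that for some constants $M_f,M_g$ $$|f(x)-f(y)|\le M_f\|x-y\|_E,\qquad |g(x)-g(y)|\le M_g\|x-y\|_E\qquad\text{for all }x,y\in X.$$ Let $\varepsilon>0$ and let $\Theta_0>0$ be a known constant with $d(x_* )\le\Theta_0^2$. Then the Adaptive Mirror Descent algorithm (described in the context), run with inputs $\varepsilon$ and $\Theta_0$, stops after not more than $$k=\left\lceil\frac{2\max\{M_f^2,M_g^2\}\,\Theta_0^2}{\varepsilon^2}\right\rceil$$ iterations, and its output $\bar x^k$ is an $\varepsilon$-solution of the problem, i.e. $$f(\bar x^k)-f(x_* )\le\varepsilon,\qquad g(\bar x^k)\le\varepsilon .$$
   Context: **Problem.** $E$ is a finite-dimensional real vector space with norm $\|\cdot\|_E$, $E^*$ its dual, $\langle p,x\rangle$ the value of $p\in E^*$ at $x\in E$, and $\|p\|_{E,*}=\max\{\langle p,x\rangle:\|x\|_E\le1\}$. $X\subset E$ is closed and convex; $f:X\to\mathbb{R}$ and $g:E\to\mathbb{R}$ are convex. The problem is regular: there is a point $\bar x$ in the relative interior of $X$ with $g(\bar x)<0$. $\nabla f(x)$, $\nabla g(x)$ denote any subgradients of $f$, $g$ at $x$. **Proximal setup.** $d$ is a prox-function: it is continuous and convex on $X$; on the set $X^0\subseteq X$ of points where a subgradient of $d$ exists it admits a continuous selection of subgradients $\nabla d(x)$; it is 1-strongly convex: $d(y)-d(x)-\langle\nabla d(x),y-x\rangle\ge\frac12\|y-x\|_E^2$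 for $x\in X^0,y\in X$; and $\min_{x\in X}d(x)=0$. For $z\in X^0$, $x\in X$ the Bregman divergence is $V[z](x)=d(x)-d(z)-\langle\nabla d(z),x-z\rangle$. For $x\in X^0$, $p\in E^*$, the Mirror Descent step is $\mathrm{Mirr}[x](p)=\arg\min_{u\in X}\{\langle p,u\rangle+V[x](u)\}$, assumed to be easily computable. **Algorithm (Adaptive Mirror Descent).** Start with $x^0=\arg\min_{x\in X}d(x)$, $I=\emptyset$, $k=0$. Repeat: - if $g(x^k)\le\varepsilon$ (productive step): $M_k=\|\nabla f(x^k)\|_{E,*}$, $h_k=\varepsilon/M_k^2$, $x^{k+1}=\mathrm{Mirr}[x^k](h_k\nabla f(x^k))$, and add $k$ to $I$; - otherwise (non-productive step): $M_k=\|\nabla g(x^k)\|_{E,*}$, $h_k=\varepsilon/M_k^2$, $x^{k+1}=\mathrm{Mirr}[x^k](h_k\nabla g(x^k))$; - set $k\leftarrow k+1$; until $\sum_{j=0}^{k-1}\frac1{M_j^2}\ge\frac{2\Theta_0^2}{\varepsilon^2}$. Output $\bar x^k=\frac{\sum_{i\in I}h_ix^i}{\sum_{i\in I}h_i}$.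
   Formalization: At boundary points of X the chosen subgradients ∇f, ∇g are assumed to have dual norm at most M_f, M_g respectively, and M_k ≠ 0 is assumed at every productive step carried out; otherwise the iteration bound can fail or h_k is undefined. *)

theory Defs
  imports "HOL-Analysis.Analysis"
begin

text \<open>
  The norm of \<open>E\<close> is the norm of a type \<open>'a :: real_normed_vector\<close>; that \<open>E\<close> is finite-dimensional
  is a separate assumption on \<open>'a\<close>, under which every linear functional is bounded and
  \<open>'a \<Rightarrow>\<^sub>L real\<close> is the whole dual space. A function on \<open>X\<close> is a total function whose values outside
  \<open>X\<close> are never used.
\<close>

definition finite_dimensional :: "'a::real_vector itself \<Rightarrow> bool" where
  "finite_dimensional _ \<longleftrightarrow> (\<exists>B::'a set. finite B \<and> span B = UNIV)"

definition dual_norm :: "('a::real_normed_vector \<Rightarrow>\<^sub>L real) \<Rightarrow> real" where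
  "dual_norm p = (SUP x\<in>{x. norm x \<le> 1}. blinfun_apply p x)"

text \<open>Subgradients at \<open>x \<in> S\<close> of a function with domain \<open>S\<close>.\<close>

definition subgradients ::
    "'a::real_normed_vector set \<Rightarrow> ('a \<Rightarrow> real) \<Rightarrow> 'a \<Rightarrow> ('a \<Rightarrow>\<^sub>L real) set" where
  "subgradients S f x = {p. \<forall>y\<in>S. f x + blinfun_apply p (y - x) \<le> f y}"

definition prox_domain :: "'a::real_normed_vector set \<Rightarrow> ('a \<Rightarrow> real) \<Rightarrow> 'a set" where
  "prox_domain X d = {x\<in>X. subgradients X d x \<noteq> {}}"

definition bregman ::
    "('a::real_normed_vector \<Rightarrow> real) \<Rightarrow> ('a \<Rightarrow> 'a \<Rightarrow>\<^sub>L real) \<Rightarrow> 'a \<Rightarrow> 'a \<Rightarrow> real" where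
  "bregman d gradd z x = d x - d z - blinfun_apply (gradd z) (x - z)"

definition prox_function ::
    "'a::real_normed_vector set \<Rightarrow> ('a \<Rightarrow> real) \<Rightarrow> ('a \<Rightarrow> 'a \<Rightarrow>\<^sub>L real) \<Rightarrow> bool" where
  "prox_function X d gradd \<longleftrightarrow>
     continuous_on X d \<and> convex_on X d \<and>
     (\<forall>x\<in>prox_domain X d. gradd x \<in> subgradients X d x) \<and>
     continuous_on (prox_domain X d) gradd \<and>
     (\<forall>x\<in>prox_domain X d. \<forall>y\<in>X. bregman d gradd x y \<ge> 1 / 2 * (norm (y - x))\<^sup>2) \<and>
     (\<forall>x\<in>X. 0 \<le> d x) \<and> (\<exists>x\<in>X. d x = 0)"

definition mirr ::
    "'a::real_normed_vector set \<Rightarrow> ('a \<Rightarrow> real) \<Rightarrow> ('a \<Rightarrow> 'a \<Rightarrow>\<^sub>L real) \<Rightarrow> 'a \<Rightarrow> ('a \<Rightarrow>\<^sub>L real) \<Rightarrow> 'a" where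
  "mirr X d gradd x p = arg_min_on (\<lambda>u. blinfun_apply p u + bregman d gradd x u) X"

definition md_direction ::
    "('a::real_normed_vector \<Rightarrow> real) \<Rightarrow> ('a \<Rightarrow> 'a \<Rightarrow>\<^sub>L real) \<Rightarrow> ('a \<Rightarrow> 'a \<Rightarrow>\<^sub>L real) \<Rightarrow>
     real \<Rightarrow> 'a \<Rightarrow> 'a \<Rightarrow>\<^sub>L real" where
  "md_direction g gradf gradg \<epsilon> x = (if g x \<le> \<epsilon> then gradf x else gradg x)"

definition md_stepsize ::
    "('a::real_normed_vector \<Rightarrow> real) \<Rightarrow> ('a \<Rightarrow> 'a \<Rightarrow>\<^sub>L real) \<Rightarrow> ('a \<Rightarrow> 'a \<Rightarrow>\<^sub>L real) \<Rightarrow>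
     real \<Rightarrow> 'a \<Rightarrow> real" where
  "md_stepsize g gradf gradg \<epsilon> x = \<epsilon> / (dual_norm (md_direction g gradf gradg \<epsilon> x))\<^sup>2"

text \<open>
  The iterates are continued for all \<open>k\<close>; the stopping rule is imposed separately below.
\<close>

primrec md_iterate ::
    "'a::real_normed_vector set \<Rightarrow> ('a \<Rightarrow> real) \<Rightarrow> ('a \<Rightarrow> 'a \<Rightarrow>\<^sub>L real) \<Rightarrow>
     ('a \<Rightarrow> real) \<Rightarrow> ('a \<Rightarrow> 'a \<Rightarrow>\<^sub>L real) \<Rightarrow> ('a \<Rightarrow> 'a \<Rightarrow>\<^sub>L real) \<Rightarrow> real \<Rightarrow> nat \<Rightarrow> 'a" where
  "md_iterate X d gradd g gradf gradg \<epsilon> 0 = arg_min_on d X"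
| "md_iterate X d gradd g gradf gradg \<epsilon> (Suc k) =
     (let x = md_iterate X d gradd g gradf gradg \<epsilon> k in
      mirr X d gradd x
        (md_stepsize g gradf gradg \<epsilon> x *\<^sub>R md_direction g gradf gradg \<epsilon> x))"

text \<open>
  For the remaining notions \<open>x\<close> is the sequence of iterates and \<open>M j = \<parallel>\<nabla>f(x\<^sup>j)\<parallel>\<close> or \<open>\<parallel>\<nabla>g(x\<^sup>j)\<parallel>\<close>
  (dual norms), according to the type of step \<open>j\<close>.

  The loop has the form ``repeat \<dots> until'': the test is made for \<open>k = 1, 2, \<dots>\<close>, and step number \<open>k\<close>
  (counted from \<open>0\<close>) is carried out if and only if no test for \<open>1 \<le> j \<le> k\<close> has succeeded.
\<close>

definition md_test :: "(nat \<Rightarrow> real) \<Rightarrow> real \<Rightarrow> real \<Rightarrow> nat \<Rightarrow> bool" where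
  "md_test M \<epsilon> \<Theta>\<^sub>0 k \<longleftrightarrow> (\<Sum>j<k. 1 / (M j)\<^sup>2) \<ge> 2 * \<Theta>\<^sub>0\<^sup>2 / \<epsilon>\<^sup>2"

definition md_executes :: "(nat \<Rightarrow> real) \<Rightarrow> real \<Rightarrow> real \<Rightarrow> nat \<Rightarrow> bool" where
  "md_executes M \<epsilon> \<Theta>\<^sub>0 k \<longleftrightarrow> (\<forall>j. 1 \<le> j \<and> j \<le> k \<longrightarrow> \<not> md_test M \<epsilon> \<Theta>\<^sub>0 j)"

definition md_stops_after :: "(nat \<Rightarrow> real) \<Rightarrow> real \<Rightarrow> real \<Rightarrow> nat \<Rightarrow> bool" where
  "md_stops_after M \<epsilon> \<Theta>\<^sub>0 k \<longleftrightarrow>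
     1 \<le> k \<and> md_test M \<epsilon> \<Theta>\<^sub>0 k \<and> (\<forall>j. 1 \<le> j \<and> j < k \<longrightarrow> \<not> md_test M \<epsilon> \<Theta>\<^sub>0 j)"

definition md_productive :: "('a \<Rightarrow> real) \<Rightarrow> (nat \<Rightarrow> 'a) \<Rightarrow> real \<Rightarrow> nat \<Rightarrow> nat set" where
  "md_productive g x \<epsilon> k = {i. i < k \<and> g (x i) \<le> \<epsilon>}"

definition md_output ::
    "('a::real_normed_vector \<Rightarrow> real) \<Rightarrow> (nat \<Rightarrow> 'a) \<Rightarrow> (nat \<Rightarrow> real) \<Rightarrow> real \<Rightarrow> nat \<Rightarrow> 'a" where
  "md_output g x h \<epsilon> k =
     (\<Sum>i\<in>md_productive g x \<epsilon> k. h i *\<^sub>R x i) /\<^sub>R (\<Sum>i\<in>md_productive g x \<epsilon> k. h i)"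

end

theory Submission
  imports Defs
begin

text \<open>
  Every Mirror Descent step \<open>u = mirr X d gradd z p\<close> satisfies, for every \<open>y \<in> X\<close>,
  \<open>p (z - y) \<le> \<parallel>p\<parallel>\<^sup>2 / 2 + V[z](y) - V[u](y)\<close> (\<open>mirr_step\<close>). Summing along the iterates
  telescopes the divergences, and since \<open>V[x\<^sup>0](x\<^sub>*) \<le> d x\<^sub>* \<le> \<Theta>\<^sub>0\<^sup>2\<close> this gives
  (\<open>mirror_descent_regret\<close>), with \<open>p\<^sub>i\<close> the chosen subgradient of \<open>f\<close> or \<open>g\<close> at \<open>x\<^sup>i\<close>,
  \<open>\<Sum> h\<^sub>i p\<^sub>i (x\<^sup>i - x\<^sub>*) \<le> \<Theta>\<^sub>0\<^sup>2 + \<Sum> h\<^sub>i\<^sup>2 M\<^sub>i\<^sup>2 / 2 = \<Theta>\<^sub>0\<^sup>2 + \<epsilon>/2 \<Sum> h\<^sub>i\<close>.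
  The stopping test says precisely that \<open>\<Theta>\<^sub>0\<^sup>2 \<le> \<epsilon>/2 \<Sum> h\<^sub>i\<close>, so the right-hand side is at most
  \<open>\<epsilon> \<Sum> h\<^sub>i\<close>, summed over all steps. A non-productive step contributes more than \<open>\<epsilon> h\<^sub>i\<close> to the left-hand
  side, because there \<open>g (x\<^sup>i) > \<epsilon>\<close> while \<open>g x\<^sub>* \<le> 0\<close>. Cancelling these steps leaves
  \<open>\<Sum> h\<^sub>i (f (x\<^sup>i) - f x\<^sub>*) \<le> \<epsilon> \<Sum> h\<^sub>i\<close> over the productive ones, of which there is at least one since
  the contribution of the others is strict. Convexity carries the bounds on \<open>f\<close> and \<open>g\<close> over to the
  weighted average. The number of steps is controlled by \<open>M\<^sub>i\<^sup>2 \<le> max (Mf\<^sup>2) (Mg\<^sup>2)\<close>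
  (\<open>md_stops_within\<close>).

  The delicate point is the optimality condition behind \<open>mirr_step\<close>. Minimality of \<open>u\<close> says that
  \<open>q = gradd z - p\<close> is some subgradient of \<open>d\<close> at \<open>u\<close>, whereas the telescoping needs the variational
  inequality \<open>q (y - u) \<le> gradd u (y - u)\<close> for the selected one; on the boundary of \<open>X\<close> the two may
  differ. Continuity of the selection settles it (\<open>selected_subgradient_optimality\<close>): by monotonicity
  of subgradients \<open>(gradd w - q) (w - u) \<ge> 0\<close> for every \<open>w\<close> in the prox-domain, and one lets \<open>w\<close>
  tend to \<open>u\<close> from the direction of \<open>y\<close>. Such \<open>w\<close> exist because the prox-domain is dense in \<open>X\<close>
  (\<open>prox_domain_dense\<close>). The same inequality with \<open>q = 0\<close> gives \<open>V[x\<^sup>0](y) \<le> d y\<close>.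

  Density, and the existence of the minimisers that define the steps, rest on finite dimension, through
  compactness of bounded closed sets and an inner product that dominates the square of the norm.
\<close>

section \<open>Finite-dimensional normed spaces\<close>

lemma compact_coordinate_box:
  fixes B :: "'a::real_normed_vector set"
  assumes "finite B"
  shows "compact {\<Sum>b\<in>B. c b *\<^sub>R b |c. \<forall>b\<in>B. \<bar>c b\<bar> \<le> r}"
  using assms
proof (induction B rule: finite_induct)
  case empty
  then show ?case by simp
next
  case (insert a B)
  let ?box = "\<lambda>B::'a set. {\<Sum>b\<in>B. c b *\<^sub>R b |c. \<forall>b\<in>B. \<bar>c b\<bar> \<le> r}"
  have "?box (insert a B) = {u + v |u v. u \<in> (\<lambda>t. t *\<^sub>R a) ` {-r..r} \<and> v \<in> ?box B}"
  proof (intro subset_antisym subsetI)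
    fix y assume "y \<in> ?box (insert a B)"
    then obtain c where c: "y = (\<Sum>b\<in>insert a B. c b *\<^sub>R b)" "\<forall>b\<in>insert a B. \<bar>c b\<bar> \<le> r"
      by blast
    have "y = c a *\<^sub>R a + (\<Sum>b\<in>B. c b *\<^sub>R b)"
      using insert c by simp
    moreover have "c a *\<^sub>R a \<in> (\<lambda>t. t *\<^sub>R a) ` {-r..r}"
      using c(2) by (auto simp: abs_le_iff)
    ultimately show "y \<in> {u + v |u v. u \<in> (\<lambda>t. t *\<^sub>R a) ` {-r..r} \<and> v \<in> ?box B}"
      using c(2) by blast
  next
    fix y assume "y \<in> {u + v |u v. u \<in> (\<lambda>t. t *\<^sub>R a) ` {-r..r} \<and> v \<in> ?box B}"
    then obtain t c where t: "y = t *\<^sub>R a + (\<Sum>b\<in>B. c b *\<^sub>R b)" "\<bar>t\<bar> \<le> r"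
      and c: "\<forall>b\<in>B. \<bar>c b\<bar> \<le> r"
      by (auto simp: abs_le_iff)
    have "(\<Sum>b\<in>B. (c(a := t)) b *\<^sub>R b) = (\<Sum>b\<in>B. c b *\<^sub>R b)"
      using insert by (intro sum.cong) auto
    then have "y = (\<Sum>b\<in>insert a B. (c(a := t)) b *\<^sub>R b)"
      using insert t by simp
    moreover have "\<forall>b\<in>insert a B. \<bar>(c(a := t)) b\<bar> \<le> r"
      using t c by simp
    ultimately show "y \<in> ?box (insert a B)" by blast
  qed
  moreover have "compact ((\<lambda>t. t *\<^sub>R a) ` {-r..r})"
    by (intro compact_continuous_image continuous_intros) auto
  ultimately show ?case
    using compact_sums[OF _ insert.IH] by simp
qed

text \<open>
  By induction on the basis. If \<open>a\<close> lies outside the span of \<open>B\<close>, it has positive distance from it: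
  by the induction hypothesis a bounded part of the span lies in a coordinate box, which is compact and
  so closed. The coefficient of \<open>a\<close> in a vector \<open>w\<close> is then at most \<open>\<parallel>w\<parallel>\<close> over this distance.
\<close>

lemma independent_coefficient_bound:
  fixes B :: "'a::real_normed_vector set"
  assumes "finite B" "independent B"
  shows "\<exists>K>0. \<forall>c. \<forall>b\<in>B. \<bar>c b\<bar> \<le> K * norm (\<Sum>b\<in>B. c b *\<^sub>R b)"
  using assms
proof (induction B rule: finite_induct)
  case empty
  then show ?case by (auto intro: exI[of _ 1])
next
  case (insert a B)
  have a: "a \<notin> span B" and B: "independent B"
    using insert by (auto simp: independent_insert)
  obtain K where K: "K > 0" "\<And>c b. b \<in> B \<Longrightarrow> \<bar>c b\<bar> \<le> K * norm (\<Sum>b\<in>B. c b *\<^sub>R b)"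
    using insert.IH[OF B] by blast
  define r where "r = K * (norm a + 1)"
  let ?box = "{\<Sum>b\<in>B. c b *\<^sub>R b |c. \<forall>b\<in>B. \<bar>c b\<bar> \<le> r}"
  have "closed ?box"
    by (intro compact_imp_closed compact_coordinate_box insert)
  moreover have "a \<notin> ?box"
  proof
    assume "a \<in> ?box"
    then obtain c where "a = (\<Sum>b\<in>B. c b *\<^sub>R b)" by blast
    also have "\<dots> \<in> span B" by (intro span_sum span_scale span_base)
    finally show False using a by simp
  qed
  ultimately obtain e where e: "e > 0" "\<And>y. dist y a < e \<Longrightarrow> y \<notin> ?box"
    unfolding closed_def open_dist by (metis (no_types, lifting) ComplD ComplI)
  define \<delta> where "\<delta> = min e 1"
  have \<delta>: "\<delta> > 0" "\<delta> \<le> 1" "\<delta> \<le> e" using e by (auto simp: \<delta>_def)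
  \<comment> \<open>the cap by 1 puts every point \<open>v\<close> of the span with \<open>dist v a < \<delta>\<close> into the box\<close>
  have away: "\<delta> \<le> norm (a + (\<Sum>b\<in>B. c b *\<^sub>R b))" for c
  proof (rule ccontr)
    assume "\<not> ?thesis"
    then have less: "norm (a + (\<Sum>b\<in>B. c b *\<^sub>R b)) < \<delta>" by simp
    define v where "v = (\<Sum>b\<in>B. (- c b) *\<^sub>R b)"
    have v: "v = - (\<Sum>b\<in>B. c b *\<^sub>R b)" by (simp add: v_def sum_negf)
    have dist: "dist v a < \<delta>"
      using less by (simp add: v dist_norm norm_minus_commute add.commute)
    then have "norm v \<le> norm a + 1"
      using \<delta> norm_triangle_sub[of v a] by (simp add: dist_norm)
    then have "\<bar>- c b\<bar> \<le> r" if "b \<in> B" for b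
      using K(2)[OF that, of "\<lambda>b. - c b"] K(1) unfolding r_def v_def[symmetric]
      by (meson mult_left_mono order_trans less_imp_le)
    then have "v \<in> ?box"
      unfolding v_def by (intro CollectI exI[of _ "\<lambda>b. - c b"]) auto
    then show False using e(2)[of v] dist \<delta> by auto
  qed
  define L where "L = max (1 / \<delta>) (K * (1 + norm a / \<delta>))"
  show ?case
  proof (intro exI conjI allI ballI)
    show "L > 0" using \<delta> by (simp add: L_def less_max_iff_disj)
  next
    fix c :: "'a \<Rightarrow> real" and b assume b: "b \<in> insert a B"
    define v w where "v = (\<Sum>b\<in>B. c b *\<^sub>R b)" and "w = (\<Sum>b\<in>insert a B. c b *\<^sub>R b)"
    have w: "w = c a *\<^sub>R a + v" using insert by (simp add: v_def w_def)
    have ca: "\<bar>c a\<bar> \<le> norm w / \<delta>"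
    proof (cases "c a = 0")
      case True
      then show ?thesis using \<delta> by simp
    next
      case False
      have "w = c a *\<^sub>R (a + (\<Sum>b\<in>B. (c b / c a) *\<^sub>R b))"
        using False by (simp add: w v_def scaleR_add_right scaleR_sum_right)
      then have "norm w \<ge> \<bar>c a\<bar> * \<delta>"
        using away[of "\<lambda>b. c b / c a"] by (simp add: mult_left_mono)
      then show ?thesis using \<delta> by (simp add: field_simps)
    qed
    have "\<bar>c b\<bar> \<le> L * norm w"
    proof (cases "b = a")
      case True
      have "1 / \<delta> * norm w \<le> L * norm w"
        by (intro mult_right_mono) (auto simp: L_def)
      then show ?thesis using ca True by simp
    next
      case False
      have "norm v \<le> norm w + \<bar>c a\<bar> * norm a"
        using norm_triangle_ineq4[of w "c a *\<^sub>R a"] by (simp add: w)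
      also have "\<dots> \<le> norm w + norm w / \<delta> * norm a"
        using ca by (intro add_left_mono mult_right_mono) auto
      finally have "K * norm v \<le> K * (norm w + norm w / \<delta> * norm a)"
        using K(1) by (intro mult_left_mono) auto
      also have "\<dots> = K * (1 + norm a / \<delta>) * norm w"
        by (simp add: algebra_simps)
      also have "\<dots> \<le> L * norm w"
        by (intro mult_right_mono) (auto simp: L_def)
      finally show ?thesis
        using K(2)[of b c] b False by (simp add: v_def)
    qed
    then show "\<bar>c b\<bar> \<le> L * norm (\<Sum>b\<in>insert a B. c b *\<^sub>R b)"
      by (simp add: w_def)
  qed
qed

lemma finite_dimensional_coordinates:
  assumes "finite_dimensional TYPE('a::real_normed_vector)"
  obtains B :: "'a::real_normed_vector set" and coord :: "'a \<Rightarrow> 'a \<Rightarrow> real"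
  where "finite B" "\<And>b. b \<in> B \<Longrightarrow> bounded_linear (coord b)"
    "\<And>x. (\<Sum>b\<in>B. coord b x *\<^sub>R b) = x"
proof -
  obtain A :: "'a set" where A: "finite A" "span A = UNIV"
    using assms by (auto simp: finite_dimensional_def)
  obtain B where B: "B \<subseteq> A" "independent B" "A \<subseteq> span B"
    using maximal_independent_subset[of A] by blast
  have fin: "finite B" using A B finite_subset by blast
  have UNIV: "span B = UNIV"
    using A B by (metis span_mono span_span top.extremum_unique)
  define coord where "coord = (\<lambda>b x. representation B x b)"
  obtain K where K: "K > 0" "\<And>c b. b \<in> B \<Longrightarrow> \<bar>c b\<bar> \<le> K * norm (\<Sum>b\<in>B. c b *\<^sub>R b)"
    using independent_coefficient_bound[OF fin B(2)] by blast
  have sum: "(\<Sum>b\<in>B. coord b x *\<^sub>R b) = x" for x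
    unfolding coord_def using UNIV B(2) fin
    by (intro sum_representation_eq) auto
  have "bounded_linear (coord b)" if "b \<in> B" for b
  proof (rule bounded_linear_intro[where K = K])
    show "coord b (x + y) = coord b x + coord b y" for x y
      using UNIV B(2) by (simp add: coord_def representation_add)
    show "coord b (r *\<^sub>R x) = r *\<^sub>R coord b x" for r x
      using UNIV B(2) by (simp add: coord_def representation_scale)
    show "norm (coord b x) \<le> norm x * K" for x
      using K(2)[OF that, of "\<lambda>b. coord b x"] by (simp add: sum mult.commute)
  qed
  from fin this sum show thesis by (rule that)
qed

lemma finite_dimensional_bounded_closed_compact:
  fixes S :: "'a::real_normed_vector set"
  assumes "finite_dimensional TYPE('a)" "bounded S" "closed S"
  shows "compact S"
proof -
  obtain B :: "'a set" and coord where B: "finite B"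
    "\<And>b. b \<in> B \<Longrightarrow> bounded_linear (coord b)" "\<And>x. (\<Sum>b\<in>B. coord b x *\<^sub>R b) = x"
    using finite_dimensional_coordinates[OF assms(1)] by blast
  have "\<exists>r. \<forall>b\<in>B. \<forall>x\<in>S. \<bar>coord b x\<bar> \<le> r"
  proof -
    have "bounded (coord b ` S)" if "b \<in> B" for b
      using bounded_linear_image[OF assms(2) B(2)[OF that]] .
    then have "bounded (\<Union>b\<in>B. coord b ` S)"
      using B(1) by (intro bounded_UN) auto
    then show ?thesis by (auto simp: bounded_iff)
  qed
  then obtain r where r: "\<And>b x. b \<in> B \<Longrightarrow> x \<in> S \<Longrightarrow> \<bar>coord b x\<bar> \<le> r" by blast
  let ?box = "{\<Sum>b\<in>B. c b *\<^sub>R b |c. \<forall>b\<in>B. \<bar>c b\<bar> \<le> r}"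
  have "x \<in> ?box" if "x \<in> S" for x
    using B(3)[of x] r that by (intro CollectI exI[of _ "\<lambda>b. coord b x"]) auto
  then have "S = S \<inter> ?box" by blast
  then show ?thesis
    using closed_Int_compact[OF assms(3) compact_coordinate_box[OF B(1), of r]] by simp
qed

lemma finite_dimensional_inner_product:
  assumes "finite_dimensional TYPE('a::real_normed_vector)"
  obtains ip :: "'a::real_normed_vector \<Rightarrow> 'a \<Rightarrow> real" and \<kappa> :: real
  where "bounded_bilinear ip" "\<And>x y. ip x y = ip y x"
    "\<kappa> > 0" "\<And>x. \<kappa> * (norm x)\<^sup>2 \<le> ip x x"
proof -
  obtain B :: "'a set" and coord where B: "finite B"
    "\<And>b. b \<in> B \<Longrightarrow> bounded_linear (coord b)" "\<And>x. (\<Sum>b\<in>B. coord b x *\<^sub>R b) = x"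
    using finite_dimensional_coordinates[OF assms(1)] by blast
  define ip where "ip = (\<lambda>x y. \<Sum>b\<in>B. coord b x * coord b y)"
  define s where "s = (\<Sum>b\<in>B. (norm b)\<^sup>2)"
  have s: "s \<ge> 0" by (auto simp: s_def intro: sum_nonneg)
  have pos: "1 / (1 + s) > 0" using s by simp
  have bb: "bounded_bilinear ip"
  proof -
    have "\<exists>K. \<forall>x. \<bar>coord b x\<bar> \<le> norm x * K" if "b \<in> B" for b
      using bounded_linear.bounded[OF B(2)[OF that]] by simp
    then obtain K where K: "\<And>b x. b \<in> B \<Longrightarrow> \<bar>coord b x\<bar> \<le> norm x * K b" by metis
    show ?thesis
    proof
      show "ip (x + x') y = ip x y + ip x' y" for x x' y
        using B(2) unfolding ip_def sum.distrib[symmetric]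
        by (intro sum.cong refl) (simp add: linear_simps algebra_simps)
      show "ip x (y + y') = ip x y + ip x y'" for x y y'
        using B(2) unfolding ip_def sum.distrib[symmetric]
        by (intro sum.cong refl) (simp add: linear_simps algebra_simps)
      show "ip (r *\<^sub>R x) y = r *\<^sub>R ip x y" for r x y
        using B(2) unfolding ip_def scaleR_sum_right
        by (intro sum.cong refl) (simp add: linear_simps algebra_simps)
      show "ip x (r *\<^sub>R y) = r *\<^sub>R ip x y" for r x y
        using B(2) unfolding ip_def scaleR_sum_right
        by (intro sum.cong refl) (simp add: linear_simps algebra_simps)
      have "norm (ip x y) \<le> norm x * norm y * (\<Sum>b\<in>B. K b * K b)" for x y
      proof -
        have "norm (ip x y) \<le> (\<Sum>b\<in>B. (norm x * K b) * (norm y * K b))"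
          unfolding ip_def using K
          by (intro sum_norm_le) (auto simp: abs_mult intro!: mult_mono intro: order_trans[OF abs_ge_zero])
        then show ?thesis by (simp add: sum_distrib_left algebra_simps)
      qed
      then show "\<exists>K. \<forall>x y. norm (ip x y) \<le> norm x * norm y * K" by blast
    qed
  qed
  have "1 / (1 + s) * (norm x)\<^sup>2 \<le> ip x x" for x
  proof -
    have "norm x \<le> (\<Sum>b\<in>B. \<bar>coord b x\<bar> * norm b)"
      using norm_sum[of "\<lambda>b. coord b x *\<^sub>R b" B] by (simp add: B(3))
    then have "(norm x)\<^sup>2 \<le> (\<Sum>b\<in>B. \<bar>coord b x\<bar> * norm b)\<^sup>2"
      by (simp add: power_mono)
    also have "\<dots> \<le> (\<Sum>b\<in>B. \<bar>coord b x\<bar>\<^sup>2) * s"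
      unfolding s_def by (rule Cauchy_Schwarz_ineq_sum)
    also have "\<dots> = ip x x * s" by (simp add: ip_def power2_eq_square)
    also have "\<dots> \<le> ip x x * (1 + s)"
      by (auto simp: ip_def intro!: mult_left_mono sum_nonneg)
    finally show ?thesis using s by (simp add: field_simps)
  qed
  with bb pos show thesis
    by (intro that[of ip "1 / (1 + s)"]) (auto simp: ip_def mult.commute)
qed

text \<open>
  A minimiser over the compact set where \<open>\<phi> u \<le> \<phi> y\<close> can hold is one over all of \<open>X\<close>: elsewhere
  \<open>\<phi>\<close> exceeds \<open>\<phi> y\<close>.
\<close>

lemma finite_dimensional_minimum_exists:
  fixes X :: "'a::real_normed_vector set" and \<phi> :: "'a \<Rightarrow> real"
  assumes fd: "finite_dimensional TYPE('a)" and X: "closed X" "y \<in> X"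
    and cont: "continuous_on X \<phi>"
    and sublevel: "\<And>u. u \<in> X \<Longrightarrow> \<phi> u \<le> \<phi> y \<Longrightarrow> dist y u \<le> r"
  obtains w where "w \<in> X" "\<And>u. u \<in> X \<Longrightarrow> \<phi> w \<le> \<phi> u"
proof -
  have "compact (X \<inter> cball y r)"
    using fd X by (intro finite_dimensional_bounded_closed_compact)
      (auto intro: bounded_subset[OF bounded_cball])
  moreover have y: "y \<in> X \<inter> cball y r" using X sublevel[of y] by auto
  moreover have "continuous_on (X \<inter> cball y r) \<phi>"
    using cont continuous_on_subset by blast
  ultimately obtain w where w: "w \<in> X \<inter> cball y r" "\<And>u. u \<in> X \<inter> cball y r \<Longrightarrow> \<phi> w \<le> \<phi> u"
    using continuous_attains_inf[of "X \<inter> cball y r" \<phi>] by blast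
  have "\<phi> w \<le> \<phi> u" if "u \<in> X" for u
    using w(2)[of u] w(2)[OF y] sublevel[OF that] that by fastforce
  with w show thesis using that by blast
qed

section \<open>Dual norms of subgradients\<close>

lemma dual_norm_eq_norm: "dual_norm p = norm p"
proof (rule antisym)
  have le: "p v \<le> norm p" if "norm v \<le> 1" for v
    using norm_blinfun[of p v] mult_left_mono[OF that norm_ge_zero[of p]] by simp
  show "dual_norm p \<le> norm p"
    unfolding dual_norm_def using le by (intro cSUP_least) (auto intro: exI[of _ 0])
  have up: "p v \<le> dual_norm p" if "norm v \<le> 1" for v
    unfolding dual_norm_def using that le by (intro cSUP_upper bdd_aboveI2) auto
  have up': "p v \<le> dual_norm p * norm v" for v
  proof (cases "v = 0")
    case False
    then show ?thesis
      using up[of "v /\<^sub>R norm v"] by (simp add: blinfun.scaleR_right field_simps)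
  qed simp
  show "norm p \<le> dual_norm p"
  proof (rule norm_blinfun_bound)
    show "0 \<le> dual_norm p" using up[of 0] by simp
    show "norm (p v) \<le> dual_norm p * norm v" for v
      using up'[of v] up'[of "- v"] by (simp add: blinfun.minus_right abs_le_iff)
  qed
qed

text \<open>
  Around an interior point the subgradient inequality can be tested in every direction. The absolute
  value covers a Lipschitz constant that is negative, which is possible only if all points of \<open>S\<close> coincide.
\<close>

lemma dual_norm_subgradient_interior_le:
  assumes p: "p \<in> subgradients S \<phi> y" and y: "y \<in> interior S"
    and lip: "\<And>u v. u \<in> S \<Longrightarrow> v \<in> S \<Longrightarrow> \<bar>\<phi> u - \<phi> v\<bar> \<le> L * norm (u - v)"
  shows "dual_norm p \<le> \<bar>L\<bar>"
proof -
  obtain e where e: "e > 0" "cball y e \<subseteq> S"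
    using y mem_interior_cball by blast
  have bound: "p v \<le> \<bar>L\<bar>" if v: "norm v \<le> 1" for v
  proof -
    have "y + e *\<^sub>R v \<in> S"
      using e v by (intro subsetD[OF e(2)]) (simp add: dist_norm mult_le_cancel_left1)
    moreover have "y \<in> S" using y interior_subset by blast
    ultimately have "e * p v \<le> L * norm (e *\<^sub>R v)"
      using p lip[of "y + e *\<^sub>R v" y]
      by (fastforce simp: subgradients_def blinfun.scaleR_right)
    also have "\<dots> \<le> \<bar>L\<bar> * (e * 1)"
      using e v by (intro mult_mono) auto
    finally show ?thesis using e by (simp add: mult.commute)
  qed
  then show ?thesis
    unfolding dual_norm_def by (intro cSUP_least) (auto intro: exI[of _ 0])
qed

section \<open>Prox-functions and the Mirror Descent step\<close>

lemma arg_min_on_minimises: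
  fixes \<phi> :: "'b \<Rightarrow> real"
  assumes "w \<in> X" "\<And>u. u \<in> X \<Longrightarrow> \<phi> w \<le> \<phi> u"
  shows "arg_min_on \<phi> X \<in> X \<and> (\<forall>u\<in>X. \<phi> (arg_min_on \<phi> X) \<le> \<phi> u)"
proof -
  have "is_arg_min \<phi> (\<lambda>u. u \<in> X) (arg_min_on \<phi> X)"
    unfolding arg_min_on_def arg_min_def
    by (rule someI[of _ w]) (simp add: is_arg_min_linorder assms)
  then show ?thesis by (simp add: is_arg_min_linorder)
qed

locale prox_setup =
  fixes X :: "'a::real_normed_vector set" and d :: "'a \<Rightarrow> real"
    and gradd :: "'a \<Rightarrow> 'a \<Rightarrow>\<^sub>L real"
  assumes finite_dim: "finite_dimensional TYPE('a)"
    and closed: "closed X"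
    and prox: "prox_function X d gradd"
begin

abbreviation X0 :: "'a set" where "X0 \<equiv> prox_domain X d"
abbreviation V :: "'a \<Rightarrow> 'a \<Rightarrow> real" where "V \<equiv> bregman d gradd"

lemma
  shows d_continuous: "continuous_on X d"
    and d_convex: "convex_on X d"
    and gradd_subgradient: "z \<in> X0 \<Longrightarrow> gradd z \<in> subgradients X d z"
    and gradd_continuous: "continuous_on X0 gradd"
    and bregman_ge: "z \<in> X0 \<Longrightarrow> y \<in> X \<Longrightarrow> 1 / 2 * (norm (y - z))\<^sup>2 \<le> V z y"
    and d_nonneg: "y \<in> X \<Longrightarrow> 0 \<le> d y"
    and d_zero: "\<exists>y\<in>X. d y = 0"
  using prox by (auto simp: prox_function_def)

lemma X_convex: "convex X"
  using d_convex by (simp add: convex_on_def)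

lemma prox_domainI: "z \<in> X \<Longrightarrow> q \<in> subgradients X d z \<Longrightarrow> z \<in> X0"
  by (auto simp: prox_domain_def)

lemma prox_domain_subset: "z \<in> X0 \<Longrightarrow> z \<in> X"
  by (simp add: prox_domain_def)

lemma segment_in: "y \<in> X \<Longrightarrow> z \<in> X \<Longrightarrow> 0 \<le> t \<Longrightarrow> t \<le> 1 \<Longrightarrow> y + t *\<^sub>R (z - y) \<in> X"
  using convexD_alt[OF X_convex, of y z t] by (simp add: algebra_simps)

text \<open>
  Minimising \<open>d u + n * ip (u - y) (u - y)\<close> over \<open>X\<close> for large \<open>n\<close> yields a point near \<open>y\<close>. The penalty
  is smooth, so the first-order condition at the minimiser turns its negative gradient into a subgradient
  of \<open>d\<close> there.
\<close>

lemma prox_domain_dense: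
  assumes y: "y \<in> X" and "\<delta> > 0"
  obtains w where "w \<in> X0" "norm (w - y) \<le> \<delta>"
proof -
  obtain ip :: "'a \<Rightarrow> 'a \<Rightarrow> real" and \<kappa>
    where bb: "bounded_bilinear ip" and sym: "\<And>u v. ip u v = ip v u"
      and \<kappa>: "\<kappa> > 0" "\<And>u. \<kappa> * (norm u)\<^sup>2 \<le> ip u u"
    using finite_dimensional_inner_product[OF finite_dim] by blast
  interpret ip: bounded_bilinear ip by (rule bb)
  \<comment> \<open>large enough that a point with value at most \<open>d y\<close> lies within \<open>\<delta>\<close> of \<open>y\<close>\<close>
  define n where "n = (d y + 1) / (\<kappa> * \<delta>\<^sup>2)"
  have n: "n > 0" using \<kappa> \<open>\<delta> > 0\<close> d_nonneg[OF y] by (simp add: n_def)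
  define \<phi> where "\<phi> u = d u + n * ip (u - y) (u - y)" for u
  have near: "norm (u - y) \<le> \<delta>" if u: "u \<in> X" "\<phi> u \<le> d y" for u
  proof (rule ccontr)
    assume "\<not> ?thesis"
    then have "\<delta>\<^sup>2 \<le> (norm (u - y))\<^sup>2" using \<open>\<delta> > 0\<close> by (intro power_mono) auto
    then have "\<kappa> * \<delta>\<^sup>2 \<le> \<kappa> * (norm (u - y))\<^sup>2" using \<kappa> by simp
    also have "\<dots> \<le> ip (u - y) (u - y)" by (rule \<kappa>)
    finally have "n * (\<kappa> * \<delta>\<^sup>2) \<le> n * ip (u - y) (u - y)" using n by simp
    moreover have "n * (\<kappa> * \<delta>\<^sup>2) = d y + 1" using \<kappa> \<open>\<delta> > 0\<close> by (simp add: n_def)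
    ultimately show False using u d_nonneg[OF u(1)] by (simp add: \<phi>_def)
  qed
  have \<phi>y: "\<phi> y = d y" by (simp add: \<phi>_def ip.zero_left)
  have "continuous_on X \<phi>"
    unfolding \<phi>_def by (intro continuous_intros d_continuous ip.continuous_on)
  then obtain w where w: "w \<in> X" "\<And>u. u \<in> X \<Longrightarrow> \<phi> w \<le> \<phi> u"
    using finite_dimensional_minimum_exists[OF finite_dim closed y, of \<phi> \<delta>] near
    by (auto simp: \<phi>y dist_norm norm_minus_commute)
  define q where "q = Blinfun (\<lambda>v. - 2 * n * ip (w - y) v)"
  have q: "q v = - 2 * n * ip (w - y) v" for v
    unfolding q_def
    by (subst bounded_linear_Blinfun_apply)
      (intro bounded_linear_const_mult ip.bounded_linear_right, simp)
  have "d w + q (u - w) \<le> d u" if u: "u \<in> X" for u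
  proof -
    let ?c = "d u - d w - q (u - w)" and ?C = "n * ip (u - w) (u - w)"
    \<comment> \<open>first-order condition for \<open>w\<close>: compare with points of the segment from \<open>w\<close> to \<open>u\<close>\<close>
    have step: "0 \<le> ?c + t * ?C" if t: "0 < t" "t \<le> 1" for t
    proof -
      define w' where "w' = w + t *\<^sub>R (u - w)"
      have "d w' \<le> (1 - t) * d w + t * d u"
        using convex_onD[OF d_convex, of t w u] t w u by (simp add: w'_def algebra_simps)
      moreover have "ip (w' - y) (w' - y)
          = ip (w - y) (w - y) + 2 * t * ip (w - y) (u - w) + t\<^sup>2 * ip (u - w) (u - w)"
      proof -
        have "ip (a + t *\<^sub>R b) (a + t *\<^sub>R b) = ip a a + 2 * t * ip a b + t\<^sup>2 * ip b b" for a b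
          using sym[of b a]
          by (simp add: ip.add_left ip.add_right ip.scaleR_left ip.scaleR_right
              power2_eq_square algebra_simps)
        moreover have "w' - y = (w - y) + t *\<^sub>R (u - w)" by (simp add: w'_def)
        ultimately show ?thesis by (simp only:)
      qed
      ultimately have "\<phi> w' \<le> \<phi> w + t * (?c + t * ?C)"
        by (simp add: \<phi>_def q power2_eq_square algebra_simps)
      moreover have "\<phi> w \<le> \<phi> w'"
        using w(2) segment_in[OF w(1) u] t by (simp add: w'_def)
      ultimately have "0 \<le> t * (?c + t * ?C)" by linarith
      then show ?thesis using t by (simp add: zero_le_mult_iff)
    qed
    have "((\<lambda>t. ?c + t * ?C) \<longlongrightarrow> ?c + 0 * ?C) (at_right 0)"
      by (intro tendsto_intros)
    moreover have "\<forall>\<^sub>F t in at_right 0. 0 \<le> ?c + t * ?C"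
      by (rule eventually_mono[OF eventually_at_right_real[of 0 1]]) (use step in auto)
    ultimately have "0 \<le> ?c + 0 * ?C"
      by (intro tendsto_lowerbound[of _ _ "at_right (0::real)"]) auto
    then show ?thesis by simp
  qed
  then have "w \<in> X0" using w by (intro prox_domainI[of _ q]) (auto simp: subgradients_def)
  moreover have "norm (w - y) \<le> \<delta>" using near[OF w(1)] w(2)[OF y] by (simp add: \<phi>y)
  ultimately show thesis by (rule that)
qed

text \<open>
  Adding the subgradient inequalities of \<open>gradd w\<close> at \<open>w\<close> and of \<open>q\<close> at \<open>u\<close> gives
  \<open>0 \<le> (gradd w - q) (w - u)\<close> for every \<open>w\<close> in the prox-domain. Points of the segment from \<open>u\<close> to
  \<open>y\<close> need not lie in the prox-domain, but by density there are such \<open>w\<close> at distance at most \<open>t\<^sup>2\<close> from the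
  point with parameter \<open>t\<close>. Hence \<open>(w - u) / t\<close> tends to \<open>y - u\<close> as \<open>t\<close> tends to \<open>0\<close>, and continuity of
  \<open>gradd\<close> gives the inequality in the limit.
\<close>

lemma selected_subgradient_optimality:
  assumes u: "u \<in> X" and q: "q \<in> subgradients X d u" and y: "y \<in> X"
  shows "q (y - u) \<le> gradd u (y - u)"
proof -
  have u0: "u \<in> X0" using prox_domainI u q by blast
  define t where "t n = 1 / real (Suc n)" for n
  have t: "0 < t n" "t n \<le> 1" for n by (auto simp: t_def)
  have t_lim: "t \<longlonglongrightarrow> 0" unfolding t_def by (rule LIMSEQ_Suc[OF lim_1_over_n])
  have "\<exists>w\<in>X0. norm (w - (u + t n *\<^sub>R (y - u))) \<le> (t n)\<^sup>2" for n
    using prox_domain_dense[OF segment_in[OF u y], of "t n" "(t n)\<^sup>2"] t[of n]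
    by (metis less_imp_le zero_less_power)
  then obtain w where w: "\<And>n. w n \<in> X0" "\<And>n. norm (w n - (u + t n *\<^sub>R (y - u))) \<le> (t n)\<^sup>2"
    by metis
  define e where "e n = (w n - u) /\<^sub>R t n" for n
  have w_e: "w n - u = t n *\<^sub>R e n" for n using t[of n] by (simp add: e_def)
  have "norm (e n - (y - u)) \<le> t n" for n
  proof -
    have "w n - (u + t n *\<^sub>R (y - u)) = t n *\<^sub>R (e n - (y - u))"
      using w_e[of n] by (simp add: algebra_simps)
    then show ?thesis using w(2)[of n] t[of n] by (simp add: power2_eq_square)
  qed
  then have "(\<lambda>n. e n - (y - u)) \<longlonglongrightarrow> 0"
    using t_lim by (intro Lim_null_comparison[OF _ t_lim]) auto
  then have e_lim: "e \<longlonglongrightarrow> y - u" using LIM_zero_iff by blast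
  have "(\<lambda>n. u + t n *\<^sub>R e n) \<longlonglongrightarrow> u + 0 *\<^sub>R (y - u)"
    by (intro tendsto_intros t_lim e_lim)
  then have "w \<longlonglongrightarrow> u" by (simp flip: w_e)
  then have "(\<lambda>n. gradd (w n)) \<longlonglongrightarrow> gradd u"
    using gradd_continuous u0 w(1) by (auto simp: continuous_on_sequentially o_def)
  then have lim: "(\<lambda>n. (gradd (w n) - q) (e n)) \<longlonglongrightarrow> (gradd u - q) (y - u)"
    by (intro tendsto_intros e_lim)
  have "0 \<le> (gradd (w n) - q) (e n)" for n
  proof -
    have "d (w n) + gradd (w n) (u - w n) \<le> d u"
      using gradd_subgradient[OF w(1)] u by (simp add: subgradients_def)
    moreover have "d u + q (w n - u) \<le> d (w n)"
      using q prox_domain_subset[OF w(1)] by (simp add: subgradients_def)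
    moreover have "gradd (w n) (u - w n) = - gradd (w n) (w n - u)"
      by (metis blinfun.minus_right minus_diff_eq)
    ultimately have "0 \<le> (gradd (w n) - q) (w n - u)"
      by (simp add: blinfun.diff_left)
    then show ?thesis
      using t[of n] by (simp add: w_e blinfun.scaleR_right zero_le_mult_iff)
  qed
  then have "0 \<le> (gradd u - q) (y - u)"
    using lim by (intro LIMSEQ_le_const) auto
  then show ?thesis by (simp add: blinfun.diff_left)
qed

text \<open>
  At the minimiser \<open>z\<close> of \<open>d\<close> the functional \<open>0\<close> is a subgradient, so the selected one satisfies
  \<open>gradd z (y - z) \<ge> 0\<close>, even if it is not \<open>0\<close> itself.
\<close>

lemma prox_centre:
  fixes z defines "z \<equiv> arg_min_on d X"
  shows "z \<in> X0" and "y \<in> X \<Longrightarrow> V z y \<le> d y"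
proof -
  obtain w where "w \<in> X" "d w = 0" using d_zero by blast
  then have z: "z \<in> X" "\<And>u. u \<in> X \<Longrightarrow> d z \<le> d u"
    using arg_min_on_minimises[of w X d] d_nonneg by (auto simp: z_def)
  then have zero: "0 \<in> subgradients X d z" by (simp add: subgradients_def)
  then show "z \<in> X0" using prox_domainI z by blast
  show "V z y \<le> d y" if "y \<in> X"
    using selected_subgradient_optimality[OF z(1) zero that] d_nonneg[OF z(1)]
    by (simp add: bregman_def)
qed

text \<open>
  The step is defined by a choice operator, so that a minimiser exists has to be shown first: strong
  convexity at \<open>z\<close> confines the points that do not increase the objective to the ball of radius
  \<open>2 * norm p\<close> around \<open>z\<close>. Minimality of \<open>u\<close> then reads off as the stated subgradient relation, which
  in particular keeps \<open>u\<close> in the prox-domain.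
\<close>

lemma mirr_minimises:
  fixes p :: "'a \<Rightarrow>\<^sub>L real"
  assumes z: "z \<in> X0"
  defines "u \<equiv> mirr X d gradd z p"
  shows "u \<in> X" and "gradd z - p \<in> subgradients X d u"
proof -
  define \<phi> where "\<phi> v = p v + V z v" for v
  have zX: "z \<in> X" using z by (rule prox_domain_subset)
  have "continuous_on X \<phi>"
    unfolding \<phi>_def bregman_def by (intro continuous_intros d_continuous)
  moreover have "dist z v \<le> 2 * norm p" if v: "v \<in> X" "\<phi> v \<le> \<phi> z" for v
  proof -
    have "p v + V z v \<le> p z" using v by (simp add: \<phi>_def bregman_def)
    then have "1 / 2 * (norm (v - z))\<^sup>2 \<le> p (z - v)"
      using bregman_ge[OF z v(1)] by (simp add: blinfun.diff_right)
    also have "\<dots> \<le> norm p * norm (v - z)"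
      using norm_blinfun[of p "z - v"] by (simp add: norm_minus_commute)
    finally have "norm (v - z) * norm (v - z) \<le> norm (v - z) * (2 * norm p)"
      by (simp add: power2_eq_square algebra_simps)
    then have "norm (v - z) \<le> 2 * norm p"
      by (cases "v = z") auto
    then show ?thesis by (simp add: dist_norm norm_minus_commute)
  qed
  ultimately obtain w where "w \<in> X" "\<And>v. v \<in> X \<Longrightarrow> \<phi> w \<le> \<phi> v"
    using finite_dimensional_minimum_exists[OF finite_dim closed zX] by blast
  moreover have "u = arg_min_on \<phi> X"
    by (simp add: u_def mirr_def \<phi>_def[abs_def])
  ultimately have u: "u \<in> X" "\<And>v. v \<in> X \<Longrightarrow> \<phi> u \<le> \<phi> v"
    using arg_min_on_minimises[of w X \<phi>] by auto
  then show "u \<in> X" by blast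
  show "gradd z - p \<in> subgradients X d u"
    using u(2) by (force simp: subgradients_def \<phi>_def bregman_def
        blinfun.diff_left blinfun.diff_right)
qed

lemma mirr_in_prox_domain: "z \<in> X0 \<Longrightarrow> mirr X d gradd z p \<in> X0"
  using mirr_minimises prox_domainI by blast

text \<open>
  The optimality condition at \<open>u\<close> becomes \<open>p (u - y) \<le> V z y - V u y - V z u\<close> by the three-point
  identity for Bregman divergences. The remaining \<open>p (z - u)\<close> is absorbed by \<open>V z u\<close>, at the cost of
  \<open>\<parallel>p\<parallel>\<^sup>2 / 2\<close>, by strong convexity.
\<close>

lemma mirr_step:
  fixes p :: "'a \<Rightarrow>\<^sub>L real"
  assumes z: "z \<in> X0" and y: "y \<in> X"
  shows "p (z - y) \<le> (norm p)\<^sup>2 / 2 + V z y - V (mirr X d gradd z p) y"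
proof -
  define u where "u = mirr X d gradd z p"
  have u: "u \<in> X" "gradd z - p \<in> subgradients X d u"
    using mirr_minimises[OF z] by (simp_all add: u_def)
  have "(gradd z - p) (y - u) \<le> gradd u (y - u)"
    by (rule selected_subgradient_optimality[OF u y])
  then have three_point: "p (u - y) \<le> V z y - V u y - V z u"
    by (simp add: bregman_def blinfun.diff_left blinfun.diff_right algebra_simps)
  have "p (z - u) \<le> norm p * norm (u - z)"
    using norm_blinfun[of p "z - u"] by (simp add: norm_minus_commute)
  also have "\<dots> \<le> (norm p)\<^sup>2 / 2 + (norm (u - z))\<^sup>2 / 2"
    using sum_squares_bound[of "norm p" "norm (u - z)"] by simp
  finally have "p (z - u) \<le> (norm p)\<^sup>2 / 2 + V z u"
    using bregman_ge[OF z u(1)] by simp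
  then show ?thesis
    using three_point by (simp add: u_def blinfun.diff_right)
qed

end

section \<open>Averages, regret and termination\<close>

lemma convex_on_weighted_average_le:
  assumes \<phi>: "convex_on C \<phi>" and fin: "finite I"
    and a: "\<And>i. i \<in> I \<Longrightarrow> 0 \<le> a i" "0 < sum a I"
    and x: "\<And>i. i \<in> I \<Longrightarrow> x i \<in> C"
    and le: "(\<Sum>i\<in>I. a i * \<phi> (x i)) \<le> c * sum a I"
  shows "(\<Sum>i\<in>I. a i *\<^sub>R x i) /\<^sub>R sum a I \<in> C"
    and "\<phi> ((\<Sum>i\<in>I. a i *\<^sub>R x i) /\<^sub>R sum a I) \<le> c"
proof -
  have I: "I \<noteq> {}" using a(2) by auto
  let ?b = "\<lambda>i. a i / sum a I"
  have b: "(\<Sum>i\<in>I. ?b i) = 1" "\<And>i. i \<in> I \<Longrightarrow> 0 \<le> ?b i"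
    using a by (auto simp flip: sum_divide_distrib)
  have avg: "(\<Sum>i\<in>I. a i *\<^sub>R x i) /\<^sub>R sum a I = (\<Sum>i\<in>I. ?b i *\<^sub>R x i)"
    by (simp add: scaleR_sum_right divide_inverse mult.commute)
  show "(\<Sum>i\<in>I. a i *\<^sub>R x i) /\<^sub>R sum a I \<in> C"
    unfolding avg using \<phi> fin b x by (intro convex_sum) (auto simp: convex_on_def)
  have "\<phi> (\<Sum>i\<in>I. ?b i *\<^sub>R x i) \<le> (\<Sum>i\<in>I. ?b i * \<phi> (x i))"
    using convex_on_sum[OF fin I \<phi> b] x by blast
  also have "\<dots> = (\<Sum>i\<in>I. a i * \<phi> (x i)) / sum a I"
    by (simp add: sum_divide_distrib)
  also have "\<dots> \<le> c" using le a(2) by (simp add: divide_le_eq)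
  finally show "\<phi> ((\<Sum>i\<in>I. a i *\<^sub>R x i) /\<^sub>R sum a I) \<le> c" by (simp add: avg)
qed

context prox_setup
begin

lemma mirror_descent_regret:
  assumes x0: "x 0 = arg_min_on d X"
    and step: "\<And>k. x (Suc k) = mirr X d gradd (x k) (p k)"
    and y: "y \<in> X"
  shows "x k \<in> X0"
    and "(\<Sum>i<k. p i (x i - y)) \<le> d y + (\<Sum>i<k. (norm (p i))\<^sup>2 / 2)"
proof -
  show X0: "x k \<in> X0" for k
    using prox_centre(1) by (induction k) (simp_all add: x0 step mirr_in_prox_domain)
  have "(\<Sum>i<k. p i (x i - y)) \<le> (\<Sum>i<k. (norm (p i))\<^sup>2 / 2) + V (x 0) y - V (x k) y"
  proof (induction k)
    case (Suc k)
    then show ?case using mirr_step[OF X0[of k] y, of "p k"] by (simp add: step)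
  qed simp
  moreover have "V (x 0) y \<le> d y" using prox_centre(2)[OF y] by (simp add: x0)
  moreover have "0 \<le> V (x k) y"
    by (rule order_trans[OF _ bregman_ge[OF X0 y]]) simp
  ultimately show "(\<Sum>i<k. p i (x i - y)) \<le> d y + (\<Sum>i<k. (norm (p i))\<^sup>2 / 2)"
    by linarith
qed

end

text \<open>
  As long as the loop runs, each step adds at least \<open>1 / C\<close> to the tested sum. The first
  step is always carried out, which forces \<open>C > 0\<close>.
\<close>

lemma md_stops_within:
  assumes pos: "\<epsilon> > 0" "\<Theta>\<^sub>0 > 0"
    and bound: "\<And>k. md_executes M \<epsilon> \<Theta>\<^sub>0 k \<Longrightarrow> M k \<noteq> 0 \<and> (M k)\<^sup>2 \<le> C"
  shows "\<exists>k. md_stops_after M \<epsilon> \<Theta>\<^sub>0 k \<and> k \<le> nat \<lceil>2 * C * \<Theta>\<^sub>0\<^sup>2 / \<epsilon>\<^sup>2\<rceil>"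
proof -
  define N where "N = nat \<lceil>2 * C * \<Theta>\<^sub>0\<^sup>2 / \<epsilon>\<^sup>2\<rceil>"
  have "\<exists>j. 1 \<le> j \<and> j \<le> N \<and> md_test M \<epsilon> \<Theta>\<^sub>0 j"
  proof (rule ccontr)
    assume none: "\<not> ?thesis"
    then have M: "M k \<noteq> 0 \<and> (M k)\<^sup>2 \<le> C" if "k \<le> N" for k
      using that by (intro bound) (auto simp: md_executes_def)
    have C: "C > 0" using M[of 0] by (smt (verit) zero_less_power2 le0)
    have N: "real N \<ge> 2 * C * \<Theta>\<^sub>0\<^sup>2 / \<epsilon>\<^sup>2" unfolding N_def by (rule real_nat_ceiling_ge)
    moreover have "2 * C * \<Theta>\<^sub>0\<^sup>2 / \<epsilon>\<^sup>2 > 0" using C pos by simp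
    ultimately have "1 \<le> N" by (cases N) auto
    have "2 * \<Theta>\<^sub>0\<^sup>2 / \<epsilon>\<^sup>2 \<le> real N * (1 / C)"
      using N C by (simp add: field_simps)
    also have "\<dots> = (\<Sum>j<N. 1 / C)" by simp
    also have "\<dots> \<le> (\<Sum>j<N. 1 / (M j)\<^sup>2)"
    proof (intro sum_mono)
      fix j assume "j \<in> {..<N}"
      then have "M j \<noteq> 0" "(M j)\<^sup>2 \<le> C" using M[of j] by auto
      then show "1 / C \<le> 1 / (M j)\<^sup>2" by (intro divide_left_mono) (auto simp: C)
    qed
    finally have "md_test M \<epsilon> \<Theta>\<^sub>0 N" by (simp add: md_test_def)
    with none \<open>1 \<le> N\<close> show False by blast
  qed
  then obtain j where j: "1 \<le> j" "j \<le> N" "md_test M \<epsilon> \<Theta>\<^sub>0 j" by blast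
  define k where "k = (LEAST k. 1 \<le> k \<and> md_test M \<epsilon> \<Theta>\<^sub>0 k)"
  have "1 \<le> k \<and> md_test M \<epsilon> \<Theta>\<^sub>0 k" unfolding k_def using j by (intro LeastI) blast
  moreover have "k \<le> i" if "1 \<le> i" "md_test M \<epsilon> \<Theta>\<^sub>0 i" for i
    unfolding k_def using that by (intro Least_le) blast
  ultimately have "md_stops_after M \<epsilon> \<Theta>\<^sub>0 k" "k \<le> N"
    using j by (force simp: md_stops_after_def)+
  then show ?thesis by (auto simp: N_def)
qed

lemma md_stops_after_executes:
  "md_stops_after M \<epsilon> \<Theta>\<^sub>0 k \<Longrightarrow> i < k \<Longrightarrow> md_executes M \<epsilon> \<Theta>\<^sub>0 i"
  by (auto simp: md_stops_after_def md_executes_def)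

section \<open>Convergence of Adaptive Mirror Descent\<close>

theorem theorem1:
  fixes X :: "'a::real_normed_vector set"
    and f g d :: "'a \<Rightarrow> real"
    and gradf gradg gradd :: "'a \<Rightarrow> 'a \<Rightarrow>\<^sub>L real"
    and Mf Mg \<epsilon> \<Theta>\<^sub>0 :: real
    and xstar :: 'a
    and x :: "nat \<Rightarrow> 'a" and M h :: "nat \<Rightarrow> real"
  assumes findim: "finite_dimensional TYPE('a)"
    and X: "closed X" "convex X"
    and f_convex: "convex_on X f"
    and g_convex: "convex_on UNIV g"
    and regular: "\<exists>z\<in>rel_interior X. g z < 0"
    and gradf: "\<And>y. y \<in> X \<Longrightarrow> gradf y \<in> subgradients X f y"
    and gradg: "\<And>y. y \<in> X \<Longrightarrow> gradg y \<in> subgradients UNIV g y"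
    and prox: "prox_function X d gradd"
    and solution: "is_arg_min f (\<lambda>y. y \<in> X \<and> g y \<le> 0) xstar"
    and f_lipschitz: "\<And>y z. y \<in> X \<Longrightarrow> z \<in> X \<Longrightarrow> \<bar>f y - f z\<bar> \<le> Mf * norm (y - z)"
    and g_lipschitz: "\<And>y z. y \<in> X \<Longrightarrow> z \<in> X \<Longrightarrow> \<bar>g y - g z\<bar> \<le> Mg * norm (y - z)"
    \<comment> \<open>automatic at interior points of \<open>X\<close>; at boundary points, where the subgradients
       may be unbounded, it restricts the choice of \<open>\<nabla>f\<close> and \<open>\<nabla>g\<close>\<close>
    and gradf_frontier: "\<And>y. y \<in> frontier X \<Longrightarrow> dual_norm (gradf y) \<le> Mf"
    and gradg_frontier: "\<And>y. y \<in> frontier X \<Longrightarrow> dual_norm (gradg y) \<le> Mg"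
    and eps: "\<epsilon> > 0"
    and Theta: "\<Theta>\<^sub>0 > 0" "d xstar \<le> \<Theta>\<^sub>0\<^sup>2"
    and x_def: "x = md_iterate X d gradd g gradf gradg \<epsilon>"
    and M_def: "M = (\<lambda>k. dual_norm (md_direction g gradf gradg \<epsilon> (x k)))"
    and h_def: "h = (\<lambda>k. md_stepsize g gradf gradg \<epsilon> (x k))"
    \<comment> \<open>no division by zero in \<open>h\<^sub>k = \<epsilon> / M\<^sub>k\<^sup>2\<close> at the productive steps carried out\<close>
    and wellposed: "\<And>k. md_executes M \<epsilon> \<Theta>\<^sub>0 k \<Longrightarrow> g (x k) \<le> \<epsilon> \<Longrightarrow> M k \<noteq> 0"
  shows "\<exists>k. md_stops_after M \<epsilon> \<Theta>\<^sub>0 k \<and>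
             k \<le> nat \<lceil>2 * max (Mf\<^sup>2) (Mg\<^sup>2) * \<Theta>\<^sub>0\<^sup>2 / \<epsilon>\<^sup>2\<rceil> \<and>
             md_productive g x \<epsilon> k \<noteq> {} \<and> md_output g x h \<epsilon> k \<in> X \<and>
             f (md_output g x h \<epsilon> k) - f xstar \<le> \<epsilon> \<and>
             g (md_output g x h \<epsilon> k) \<le> \<epsilon>"
proof -
  interpret prox_setup X d gradd
    using findim X(1) prox by unfold_locales
  have xs: "xstar \<in> X" "g xstar \<le> 0"
    using solution by (auto simp: is_arg_min_def)
  obtain z where z: "g z < 0" using regular by blast
  define G where "G = (\<lambda>k. md_direction g gradf gradg \<epsilon> (x k))"
  have M: "M k = norm (G k)" for k by (simp add: M_def G_def dual_norm_eq_norm)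
  have h: "h k = \<epsilon> / (M k)\<^sup>2" for k by (simp add: h_def md_stepsize_def M_def)
  have x_simps: "x 0 = arg_min_on d X" "x (Suc k) = mirr X d gradd (x k) (h k *\<^sub>R G k)" for k
    by (simp_all add: x_def h_def G_def Let_def)
  note regret = mirror_descent_regret[of x "\<lambda>k. h k *\<^sub>R G k", OF x_simps xs(1)]
  have xX: "x k \<in> X" for k using regret(1) prox_domain_subset by blast
  have productive: "G k (x k - xstar) \<ge> f (x k) - f xstar" if "g (x k) \<le> \<epsilon>" for k
  proof -
    have "f (x k) + G k (xstar - x k) \<le> f xstar"
      using gradf[OF xX[of k]] xs(1) that by (simp add: G_def md_direction_def subgradients_def)
    then show ?thesis by (simp add: blinfun.diff_right)
  qed
  have unproductive: "G k (x k - y) \<ge> g (x k) - g y" if "\<not> g (x k) \<le> \<epsilon>" for k y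
  proof -
    have "g (x k) + G k (y - x k) \<le> g y"
      using gradg[OF xX[of k]] that by (simp add: G_def md_direction_def subgradients_def)
    then show ?thesis by (simp add: blinfun.diff_right)
  qed
  have M_nonzero: "M k \<noteq> 0" if "md_executes M \<epsilon> \<Theta>\<^sub>0 k" for k
  proof (cases "g (x k) \<le> \<epsilon>")
    case True
    then show ?thesis by (rule wellposed[OF that])
  next
    case False
    \<comment> \<open>a zero subgradient of \<open>g\<close> would make \<open>x k\<close> a global minimiser of \<open>g\<close>, against \<open>g z < 0 < g (x k)\<close>\<close>
    then have "G k \<noteq> 0" using unproductive[OF False, of z] z eps by auto
    then show ?thesis by (simp add: M)
  qed
  have sq_le: "(dual_norm p)\<^sup>2 \<le> L\<^sup>2" if "dual_norm p \<le> \<bar>L\<bar>" for p :: "'a \<Rightarrow>\<^sub>L real" and L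
    using power_mono[OF that, of 2] by (simp add: dual_norm_eq_norm)
  have X_cases: "y \<in> interior X \<or> y \<in> frontier X" if "y \<in> X" for y
    using that X(1) by (auto simp: frontier_def)
  have gradf_le: "(dual_norm (gradf y))\<^sup>2 \<le> Mf\<^sup>2" if "y \<in> X" for y
    using X_cases[OF that] gradf_frontier[of y]
      dual_norm_subgradient_interior_le[OF gradf[OF that] _ f_lipschitz]
    by (intro sq_le) force
  have gradg_le: "(dual_norm (gradg y))\<^sup>2 \<le> Mg\<^sup>2" if "y \<in> X" for y
  proof -
    have "gradg y \<in> subgradients X g y"
      using gradg[OF that] by (simp add: subgradients_def)
    then show ?thesis
      using X_cases[OF that] gradg_frontier[of y]
        dual_norm_subgradient_interior_le[OF _ _ g_lipschitz]
      by (intro sq_le) force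
  qed
  have M_le: "(M k)\<^sup>2 \<le> max (Mf\<^sup>2) (Mg\<^sup>2)" for k
    using gradf_le[OF xX[of k]] gradg_le[OF xX[of k]]
    by (auto simp: M_def md_direction_def le_max_iff_disj)
  obtain k where k: "md_stops_after M \<epsilon> \<Theta>\<^sub>0 k"
      "k \<le> nat \<lceil>2 * max (Mf\<^sup>2) (Mg\<^sup>2) * \<Theta>\<^sub>0\<^sup>2 / \<epsilon>\<^sup>2\<rceil>"
    using md_stops_within[OF eps Theta(1), of M] M_nonzero M_le by blast
  have M_k: "M i \<noteq> 0" if "i < k" for i
    using M_nonzero md_stops_after_executes[OF k(1) that] .
  have h_pos: "h i > 0" if "i < k" for i
    using M_k[OF that] eps by (simp add: h)
  define I J where "I = md_productive g x \<epsilon> k" and "J = {..<k} - I"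
  have I: "i < k" "g (x i) \<le> \<epsilon>" if "i \<in> I" for i
    using that by (auto simp: I_def md_productive_def)
  have J: "i < k" "\<not> g (x i) \<le> \<epsilon>" if "i \<in> J" for i
    using that by (auto simp: J_def I_def md_productive_def)
  have fin: "finite I" "finite J" by (auto simp: I_def J_def md_productive_def)
  have split: "(\<Sum>i<k. s i) = sum s I + sum s J" for s :: "nat \<Rightarrow> real"
    unfolding J_def using I by (intro sum.subset_diff[THEN trans]) (auto simp: add.commute)
  \<comment> \<open>the stopping test, multiplied by \<open>\<epsilon>\<^sup>2 / 2\<close>\<close>
  have "\<Theta>\<^sub>0\<^sup>2 \<le> \<epsilon> / 2 * (\<Sum>i<k. h i)"
  proof -
    have "2 * \<Theta>\<^sub>0\<^sup>2 / \<epsilon>\<^sup>2 \<le> (\<Sum>i<k. 1 / (M i)\<^sup>2)"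
      using k(1) by (simp add: md_stops_after_def md_test_def)
    then have "\<epsilon>\<^sup>2 / 2 * (2 * \<Theta>\<^sub>0\<^sup>2 / \<epsilon>\<^sup>2) \<le> \<epsilon>\<^sup>2 / 2 * (\<Sum>i<k. 1 / (M i)\<^sup>2)"
      by (intro mult_left_mono) auto
    also have "\<dots> = \<epsilon> / 2 * (\<Sum>i<k. h i)"
      by (simp add: h sum_distrib_left power2_eq_square)
    finally show ?thesis using eps by simp
  qed
  moreover have "(\<Sum>i<k. (norm (h i *\<^sub>R G i))\<^sup>2 / 2) = \<epsilon> / 2 * (\<Sum>i<k. h i)"
    unfolding sum_distrib_left
  proof (intro sum.cong refl)
    fix i assume "i \<in> {..<k}"
    then show "(norm (h i *\<^sub>R G i))\<^sup>2 / 2 = \<epsilon> / 2 * h i"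
      using M_k[of i] by (simp add: M h power_mult_distrib power2_eq_square)
  qed
  ultimately have total: "(\<Sum>i<k. h i * G i (x i - xstar)) \<le> \<epsilon> * sum h I + \<epsilon> * sum h J"
    using regret(2)[of k] Theta(2) split[of h]
    by (simp add: blinfun.scaleR_left flip: distrib_left)
  have on_I: "(\<Sum>i\<in>I. h i * (f (x i) - f xstar)) \<le> (\<Sum>i\<in>I. h i * G i (x i - xstar))"
    using I h_pos productive by (intro sum_mono mult_left_mono) (auto intro: less_imp_le)
  have J_step: "h i * \<epsilon> < h i * G i (x i - xstar)" if "i \<in> J" for i
    using unproductive[OF J(2)[OF that], of xstar] J(2)[OF that] xs(2) h_pos[OF J(1)[OF that]]
    by simp
  have on_J: "\<epsilon> * sum h J \<le> (\<Sum>i\<in>J. h i * G i (x i - xstar))"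
    unfolding sum_distrib_left using J_step
    by (intro sum_mono) (auto simp: mult.commute intro: less_imp_le)
  have I_nonempty: "I \<noteq> {}"
  proof
    assume "I = {}"
    then have "J \<noteq> {}" using k(1) by (auto simp: J_def md_stops_after_def lessThan_empty_iff)
    then have "(\<Sum>i\<in>J. h i * \<epsilon>) < (\<Sum>i\<in>J. h i * G i (x i - xstar))"
      using J_step fin by (intro sum_strict_mono) auto
    then show False
      using total split[of "\<lambda>i. h i * G i (x i - xstar)"] \<open>I = {}\<close>
      by (simp add: sum_distrib_left mult.commute)
  qed
  have sum_h: "sum h I > 0" using fin I_nonempty I h_pos by (intro sum_pos) auto
  have h_nonneg: "0 \<le> h i" if "i \<in> I" for i using h_pos I that less_imp_le by blast
  have out: "md_output g x h \<epsilon> k = (\<Sum>i\<in>I. h i *\<^sub>R x i) /\<^sub>R sum h I"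
    by (simp add: md_output_def I_def)
  have "(\<Sum>i\<in>I. h i * (f (x i) - f xstar)) \<le> \<epsilon> * sum h I"
    using total on_I on_J split[of "\<lambda>i. h i * G i (x i - xstar)"] by linarith
  then have "(\<Sum>i\<in>I. h i * f (x i)) \<le> (f xstar + \<epsilon>) * sum h I"
    by (simp add: algebra_simps sum_subtractf sum_distrib_left)
  from convex_on_weighted_average_le[OF f_convex fin(1) h_nonneg sum_h _ this]
  have f_out: "md_output g x h \<epsilon> k \<in> X" "f (md_output g x h \<epsilon> k) \<le> f xstar + \<epsilon>"
    using xX by (simp_all add: out)
  have "(\<Sum>i\<in>I. h i * g (x i)) \<le> (\<Sum>i\<in>I. h i * \<epsilon>)"
    using I h_nonneg by (intro sum_mono mult_left_mono) auto
  then have "(\<Sum>i\<in>I. h i * g (x i)) \<le> \<epsilon> * sum h I"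
    by (simp add: sum_distrib_left mult.commute)
  from convex_on_weighted_average_le(2)[OF g_convex fin(1) h_nonneg sum_h _ this]
  have "g (md_output g x h \<epsilon> k) \<le> \<epsilon>" by (simp add: out)
  with k f_out I_nonempty show ?thesis
    unfolding I_def by (intro exI[of _ k]) auto
qed

end
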